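(* Let $B$ be an injective bounded linear operator between infinite dimensional Banach spaces $Z_1$ and $Z_2$. Then the equation $Bx=y$ is ill-posed of type II if and only if $B$ is strictly singular.
   Context: For an injective bounded linear operator $B\colon Z_1\to Z_2$ between infinite dimensional Banach spaces, the equation $Bx=y$ is called well-posed if the range $\mathcal{R}(B)$ is a closed subset of $Z_2$, and ill-posed if the range is not closed. In the ill-posed case, the equation is called ill-posed of type I if $\mathcal{R}(B)$ contains an infinite dimensional closed subspace (closed in $Z_2$), and ill-posed of type II otherwise. A bounded linear operator between Banach spaces $Z_1$ and $Z_2$ is strictly singular if its restriction to an infinite dimensional subspace of $Z_1$ is never an isomorphism (onto its image). *)

theory Defs
  imports "HOL-Analysis.Analysis"
begin

text \<open>
  The class \<open>banach\<close> describes real Banach spaces.  To treat real and complex spaces at once, a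
  Banach space is a type of this class with a scalar multiplication \<open>s\<close> by a normed field that
  extends the real one; the only instances of \<^class>\<open>real_normed_field\<close> are, up to isomorphism,
  the real and the complex numbers.  Real spaces are the case \<open>s = scaleR\<close>.
\<close>

locale banach_space_over = vector_space s
  for s :: "'k::real_normed_field \<Rightarrow> 'a::banach \<Rightarrow> 'a" +
  assumes scale_of_real: "s (of_real r) x = r *\<^sub>R x"
    and norm_scale: "norm (s c x) = norm c * norm x"

lemma banach_space_over_real:
  "banach_space_over (scaleR :: real \<Rightarrow> 'a::banach \<Rightarrow> 'a)"
  by unfold_locales (simp_all add: algebra_simps)

lemma banach_space_over_complex:
  "banach_space_over ((*) :: complex \<Rightarrow> complex \<Rightarrow> complex)"
  by unfold_locales (simp_all add: algebra_simps norm_mult scaleR_conv_of_real)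

text \<open>
  The library's \<open>dim\<close> is \<open>0\<close> on infinite dimensional subspaces, so it cannot be used here.
\<close>

definition infinite_dimensional ::
  "('k::real_normed_field \<Rightarrow> 'a::banach \<Rightarrow> 'a) \<Rightarrow> 'a set \<Rightarrow> bool"
  where "infinite_dimensional s S \<longleftrightarrow>
    \<not> (\<exists>F. finite F \<and> F \<subseteq> S \<and> S \<subseteq> module.span s F)"

definition bounded_operator ::
  "('k::real_normed_field \<Rightarrow> 'a::banach \<Rightarrow> 'a) \<Rightarrow> ('k \<Rightarrow> 'b::banach \<Rightarrow> 'b) \<Rightarrow> ('a \<Rightarrow> 'b) \<Rightarrow> bool"
  where "bounded_operator s1 s2 B \<longleftrightarrow>
    Vector_Spaces.linear s1 s2 B \<and> (\<exists>K. \<forall>x. norm (B x) \<le> K * norm x)"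

text \<open>
  The predicates below classify the equation \<open>B x = y\<close> through its operator \<open>B\<close>; they are meant
  for injective bounded operators.
\<close>

definition well_posed :: "('a::banach \<Rightarrow> 'b::banach) \<Rightarrow> bool"
  where "well_posed B \<longleftrightarrow> closed (range B)"

definition ill_posed :: "('a::banach \<Rightarrow> 'b::banach) \<Rightarrow> bool"
  where "ill_posed B \<longleftrightarrow> \<not> well_posed B"

definition ill_posed_type_I ::
  "('k::real_normed_field \<Rightarrow> 'b::banach \<Rightarrow> 'b) \<Rightarrow> ('a::banach \<Rightarrow> 'b) \<Rightarrow> bool"
  where "ill_posed_type_I s2 B \<longleftrightarrow> ill_posed B \<and>
    (\<exists>M. M \<subseteq> range B \<and> module.subspace s2 M \<and> closed M \<and> infinite_dimensional s2 M)"

definition ill_posed_type_II ::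
  "('k::real_normed_field \<Rightarrow> 'b::banach \<Rightarrow> 'b) \<Rightarrow> ('a::banach \<Rightarrow> 'b) \<Rightarrow> bool"
  where "ill_posed_type_II s2 B \<longleftrightarrow> ill_posed B \<and> \<not> ill_posed_type_I s2 B"

text \<open>
  For a linear operator, being an isomorphism of \<open>N\<close> onto its image means being a homeomorphism
  onto it, as the inverse is automatically linear.  Subspaces \<open>N\<close> need not be closed.
\<close>

definition strictly_singular ::
  "('k::real_normed_field \<Rightarrow> 'a::banach \<Rightarrow> 'a) \<Rightarrow> ('k \<Rightarrow> 'b::banach \<Rightarrow> 'b) \<Rightarrow> ('a \<Rightarrow> 'b) \<Rightarrow> bool"
  where "strictly_singular s1 s2 B \<longleftrightarrow> bounded_operator s1 s2 B \<and>
    (\<forall>N. module.subspace s1 N \<and> infinite_dimensional s1 N \<longrightarrow>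
      \<not> (\<exists>g. homeomorphism N (B ` N) B g))"

end

theory Submission
  imports Defs
begin

text \<open>
  An injective bounded operator is an isomorphism on a subspace iff it is bounded below there.
  If it is bounded below on an infinite dimensional subspace, it is so on the closure, whose image is
  then a closed infinite dimensional subspace of the range. Conversely, the open mapping argument
  applied to the preimage of a closed subspace of the range shows that the operator is bounded below
  on this preimage. Finally, ``ill-posed of type II'' just says that the range, which is itself
  infinite dimensional, contains no closed infinite dimensional subspace.
\<close>

section \<open>Lower bounds for bounded linear maps\<close>

text \<open>This is the Baire half of the open mapping argument. The image of \<open>N\<close> is
  closed in a Banach space, hence completely metrizable, and is the union of the closed sets
  \<open>A n\<close>. One of them has relative interior, and differences of its points give
  approximate preimages in every direction.\<close>

lemma closed_image_approximate_preimage: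
  fixes f :: "'a::real_normed_vector \<Rightarrow> 'b::banach"
  assumes "linear f" and N: "subspace N" and M: "closed (f ` N)"
  obtains K where "0 \<le> K"
    and "\<And>y e. \<lbrakk>y \<in> f ` N; 0 < e\<rbrakk> \<Longrightarrow> \<exists>x\<in>N. norm x \<le> K * norm y \<and> norm (y - f x) < e"
proof -
  interpret f: linear f by fact
  have subM: "subspace (f ` N)" using \<open>linear f\<close> N by (rule linear_subspace_image)
  define A where "A n = closure (f ` (N \<inter> cball 0 (real n)))" for n
  have A_sub: "A n \<subseteq> f ` N" for n
    unfolding A_def by (intro closure_minimal M) auto
  have cover: "\<Union> (range A) = f ` N"
  proof
    show "f ` N \<subseteq> \<Union> (range A)"
    proof clarify
      fix x assume "x \<in> N"
      obtain n where "norm x \<le> real n" using real_arch_simple by blast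
      then have "f x \<in> A n"
        unfolding A_def using \<open>x \<in> N\<close> by (intro subsetD[OF closure_subset]) auto
      then show "f x \<in> \<Union> (range A)" by blast
    qed
  qed (use A_sub in blast)
  \<comment> \<open>Baire category relative to the image: otherwise the union of the
    \<open>A n\<close>, which is the whole image, would have empty interior, although the image
    contains \<open>0\<close>.\<close>
  have "\<exists>n. top_of_set (f ` N) interior_of A n \<noteq> {}"
  proof (rule ccontr)
    assume "\<not> ?thesis"
    then have "top_of_set (f ` N) interior_of \<Union> (range A) = {}"
      using A_sub M
      by (intro Baire_category_alt)
        (auto simp: A_def closed_subset completely_metrizable_space_closedin
           completely_metrizable_space_euclidean closed_closedin[symmetric])
    then show False
      using cover interior_of_topspace[of "top_of_set (f ` N)"] subspace_0[OF subM] by auto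
  qed
  then obtain n y0 where "y0 \<in> top_of_set (f ` N) interior_of A n" by blast
  then obtain r where r: "0 < r" and ball: "ball y0 r \<inter> f ` N \<subseteq> A n" and y0: "y0 \<in> f ` N"
    unfolding interior_of_def openin_contains_ball by blast
  show thesis
  proof
    \<comment> \<open>A difference of two points of norm at most \<open>n\<close> has norm at most
      \<open>2 * n\<close>; dividing by \<open>t = r / (2 * norm y)\<close> below yields the factor
      \<open>4 * n / r * norm y\<close>.\<close>
    show "0 \<le> 4 * real n / r" using r by simp
    fix y and e :: real assume y: "y \<in> f ` N" and e: "0 < e"
    show "\<exists>x\<in>N. norm x \<le> 4 * real n / r * norm y \<and> norm (y - f x) < e"
    proof (cases "y = 0")
      case True
      then show ?thesis using e N by (intro bexI[of _ 0]) (auto simp: f.zero subspace_0)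
    next
      case False
      \<comment> \<open>With this \<open>t\<close> the vector \<open>t *\<^sub>R y\<close> has norm
        \<open>r / 2\<close>, so translating \<open>y0\<close> by it stays in the ball.\<close>
      define t where "t = r / (2 * norm y)"
      have t: "0 < t" using r False by (simp add: t_def)
      have "norm (t *\<^sub>R y) < r" using r False by (simp add: t_def)
      moreover have "y0 + t *\<^sub>R y \<in> f ` N"
        using subM y y0 by (simp add: subspace_add subspace_scale)
      ultimately have "y0 + t *\<^sub>R y \<in> ball y0 r \<inter> f ` N"
        by (simp add: dist_norm del: norm_scaleR)
      then have "y0 + t *\<^sub>R y \<in> A n" using ball by blast
      moreover have "y0 \<in> A n" using ball y0 r by auto
      \<comment> \<open>Two errors below \<open>t * e / 2\<close> add up to less than
        \<open>t * e\<close>; after division by \<open>t\<close> this is the required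
        \<open>e\<close>. The centre \<open>y0\<close> cancels in the difference
        \<open>x1 - x2\<close>.\<close>
      moreover have te: "0 < t * e / 2" using t e by simp
      ultimately have "\<exists>x1\<in>N \<inter> cball 0 (real n). dist (f x1) (y0 + t *\<^sub>R y) < t * e / 2"
        and "\<exists>x2\<in>N \<inter> cball 0 (real n). dist (f x2) y0 < t * e / 2"
        unfolding A_def closure_approachable by blast+
      then obtain x1 x2 where x1: "x1 \<in> N" "norm x1 \<le> n" "dist (f x1) (y0 + t *\<^sub>R y) < t * e / 2"
        and x2: "x2 \<in> N" "norm x2 \<le> n" "dist (f x2) y0 < t * e / 2"
        by auto
      define x where "x = (1 / t) *\<^sub>R (x1 - x2)"
      have "x \<in> N" using N x1 x2 by (simp add: x_def subspace_diff subspace_scale)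
      moreover have "norm x \<le> 4 * real n / r * norm y"
      proof -
        have "norm x = norm (x1 - x2) / t" using t by (simp add: x_def)
        also have "\<dots> \<le> (2 * real n) / t"
          using t x1(2) x2(2) norm_triangle_ineq4[of x1 x2] by (intro divide_right_mono) auto
        also have "\<dots> = 4 * real n / r * norm y" using r False by (simp add: t_def)
        finally show ?thesis .
      qed
      moreover have "norm (y - f x) < e"
      proof -
        have "t *\<^sub>R (y - f x) = (f x2 - y0) - (f x1 - (y0 + t *\<^sub>R y))"
          using t by (simp add: x_def f.scale f.diff algebra_simps)
        then have "t * norm (y - f x) = norm ((f x2 - y0) - (f x1 - (y0 + t *\<^sub>R y)))"
          using t by (metis abs_of_pos norm_scaleR)
        also have "\<dots> < t * e"
          using x1(3) x2(3) norm_triangle_ineq4[of "f x2 - y0" "f x1 - (y0 + t *\<^sub>R y)"]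
          by (simp add: dist_norm)
        finally show ?thesis using t by simp
      qed
      ultimately show ?thesis by blast
    qed
  qed
qed

text \<open>Successive approximation makes the preimage exact: each residual is corrected by an
  approximate preimage of it. The corrections are dominated by a geometric series, so they sum to a
  point of the closed subspace \<open>N\<close>.\<close>

lemma closed_image_bounded_preimage:
  fixes f :: "'a::banach \<Rightarrow> 'b::banach"
  assumes f: "bounded_linear f" and N: "subspace N" "closed N" and M: "closed (f ` N)"
  obtains K where "0 < K"
    and "\<And>y. y \<in> f ` N \<Longrightarrow> \<exists>x\<in>N. f x = y \<and> norm x \<le> K * norm y"
proof -
  interpret f: bounded_linear f by fact
  obtain K where K: "0 \<le> K"
    and approx: "\<And>y e. \<lbrakk>y \<in> f ` N; 0 < e\<rbrakk> \<Longrightarrow> \<exists>x\<in>N. norm x \<le> K * norm y \<and> norm (y - f x) < e"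
    using closed_image_approximate_preimage[OF f.linear_axioms N(1) M] by blast
  \<comment> \<open>The geometric series gives the factor \<open>2 * K\<close>; adding
    \<open>1\<close> keeps the constant positive when \<open>K = 0\<close>. The case
    \<open>y = 0\<close> is separate because the tolerances \<open>e k\<close> would vanish
    there.\<close>
  have "\<exists>x\<in>N. f x = y \<and> norm x \<le> (2 * K + 1) * norm y" if y: "y \<in> f ` N" for y
  proof (cases "y = 0")
    case True
    then show ?thesis using N(1) by (intro bexI[of _ 0]) (auto simp: f.zero subspace_0)
  next
    case False
    define e where "e k = norm y * (1 / 2) ^ k" for k :: nat
    have e: "0 < e k" for k using False by (simp add: e_def)
    have step: "\<exists>v. (v \<in> N \<and> norm (y - f v) \<le> e (Suc k)) \<and> norm (v - u) \<le> K * e k"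
      if u: "u \<in> N \<and> norm (y - f u) \<le> e k" for u k
    proof -
      have "y - f u \<in> f ` N"
        using linear_subspace_image[OF f.linear_axioms N(1)] y u by (simp add: subspace_diff)
      then obtain x where x: "x \<in> N" "norm x \<le> K * norm (y - f u)"
        "norm (y - f u - f x) < e (Suc k)"
        using approx e by blast
      have "norm x \<le> K * e k"
        using x(2) u K by (meson mult_left_mono order_trans)
      then show ?thesis
        using x u N(1) by (intro exI[of _ "u + x"]) (auto simp: subspace_add f.add algebra_simps)
    qed
    \<comment> \<open>The clause for \<open>k = 0\<close> starts the iteration at \<open>0\<close>,
      where the residual is \<open>y\<close> and \<open>e 0 = norm y\<close>. It also makes the
      telescoping sums of increments equal to \<open>u\<close> itself.\<close>
    define P where "P k u \<longleftrightarrow> (u \<in> N \<and> norm (y - f u) \<le> e k) \<and> (k = 0 \<longrightarrow> u = 0)" for k u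
    have "\<exists>u. \<forall>k. P k (u k) \<and> norm (u (Suc k) - u k) \<le> K * e k"
    proof (rule dependent_nat_choice)
      show "\<exists>x. P 0 x"
        using N(1) by (auto simp: P_def f.zero e_def subspace_0)
      show "\<exists>v. P (Suc k) v \<and> norm (v - u) \<le> K * e k" if "P k u" for u k
        using step that by (auto simp: P_def)
    qed
    then obtain u where u: "\<And>k. P k (u k)" and du: "\<And>k. norm (u (Suc k) - u k) \<le> K * e k"
      by blast
    have u0: "u 0 = 0" and uN: "u k \<in> N" and uy: "norm (y - f (u k)) \<le> e k" for k
      using u[of k] u[of 0] by (simp_all add: P_def)
    have sums: "(\<lambda>k. K * e k) sums (K * (norm y * 2))"
      unfolding e_def using geometric_sums[of "1 / 2 :: real"] by (intro sums_mult) simp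
    have summ: "summable (\<lambda>k. u (Suc k) - u k)"
      using du sums_summable[OF sums] by (rule summable_comparison_test'[where N = 0, rotated])
    define x where "x = (\<Sum>k. u (Suc k) - u k)"
    have ux: "u \<longlonglongrightarrow> x"
      using summable_LIMSEQ[OF summ] by (simp add: x_def sum_lessThan_telescope u0)
    have "x \<in> N" using N(2) uN ux by (rule closed_sequentially)
    moreover have "f x = y"
    proof -
      have "e \<longlonglongrightarrow> norm y * 0"
        unfolding e_def by (intro tendsto_mult tendsto_const LIMSEQ_power_zero) simp
      then have "e \<longlonglongrightarrow> 0" by simp
      then have "(\<lambda>k. y - f (u k)) \<longlonglongrightarrow> 0"
        by (rule Lim_null_comparison[OF always_eventually, rotated]) (simp add: uy)
      then have "(\<lambda>k. y - (y - f (u k))) \<longlonglongrightarrow> y - 0"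
        by (intro tendsto_diff tendsto_const)
      then have "(\<lambda>k. f (u k)) \<longlonglongrightarrow> y" by simp
      then show ?thesis using f.tendsto[OF ux] LIMSEQ_unique by blast
    qed
    moreover have "norm x \<le> (2 * K + 1) * norm y"
    proof -
      have "norm x \<le> K * (norm y * 2)"
        unfolding x_def using norm_suminf_le[OF du sums_summable[OF sums]] sums_unique[OF sums] by simp
      then show ?thesis by (simp add: algebra_simps add_increasing)
    qed
    ultimately show ?thesis by blast
  qed
  moreover have "0 < 2 * K + 1" using K by simp
  ultimately show thesis using that by blast
qed

text \<open>By injectivity the bounded preimage of \<open>f x\<close> can only be \<open>x\<close>,
  which turns the bound \<open>K\<close> into the lower bound \<open>1 / K\<close>.\<close>

lemma closed_image_bounded_below:
  fixes f :: "'a::banach \<Rightarrow> 'b::banach"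
  assumes "bounded_linear f" "subspace N" "closed N" "closed (f ` N)" and inj: "inj_on f N"
  obtains c where "0 < c" and "\<And>x. x \<in> N \<Longrightarrow> c * norm x \<le> norm (f x)"
proof -
  obtain K where K: "0 < K"
    and pre: "\<And>y. y \<in> f ` N \<Longrightarrow> \<exists>x\<in>N. f x = y \<and> norm x \<le> K * norm y"
    using closed_image_bounded_preimage[OF assms(1-4)] by blast
  show thesis
  proof
    show "0 < 1 / K" using K by simp
    fix x assume x: "x \<in> N"
    then obtain x' where "x' \<in> N" "f x' = f x" "norm x' \<le> K * norm (f x)" using pre by blast
    then have "norm x \<le> K * norm (f x)" using inj x by (auto dest: inj_onD)
    then show "1 / K * norm x \<le> norm (f x)" using K by (simp add: field_simps)
  qed
qed

text \<open>Continuity of \<open>g\<close> at \<open>0\<close> sends a small ball of the image into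
  the open unit ball; homogeneity extends this to all of \<open>N\<close>.\<close>

lemma homeomorphism_imp_bounded_below:
  fixes f :: "'a::real_normed_vector \<Rightarrow> 'b::real_normed_vector"
  assumes "linear f" and N: "subspace N" and hom: "homeomorphism N (f ` N) f g"
  obtains c where "0 < c" and "\<And>x. x \<in> N \<Longrightarrow> c * norm x \<le> norm (f x)"
proof -
  interpret f: linear f by fact
  have gf: "g (f x) = x" if "x \<in> N" for x using hom that by (auto simp: homeomorphism_def)
  have "0 \<in> N" using N by (rule subspace_0)
  then have "0 \<in> f ` N" and g0: "g 0 = 0" using gf[of 0] f.zero by force+
  moreover have "continuous_on (f ` N) g" using hom by (auto simp: homeomorphism_def)
  ultimately obtain d where d: "0 < d" and small: "\<And>y. \<lbrakk>y \<in> f ` N; norm y < d\<rbrakk> \<Longrightarrow> norm (g y) < 1"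
    unfolding continuous_on_iff using zero_less_one by (metis dist_0_norm dist_commute)
  show thesis
  proof
    show "0 < d / 2" using d by simp
    fix x assume x: "x \<in> N"
    show "d / 2 * norm x \<le> norm (f x)"
    proof (rule ccontr)
      assume "\<not> ?thesis"
      then have less: "norm (f x) < d / 2 * norm x" by simp
      then have "norm x \<noteq> 0" using norm_ge_zero[of "f x"] by (metis mult_zero_right not_less)
      \<comment> \<open>A violation of the bound, normalised to the unit vector \<open>z\<close>,
        would give \<open>norm (f z) < d\<close> and hence
        \<open>norm z = norm (g (f z)) < 1\<close>.\<close>
      define z where "z = (1 / norm x) *\<^sub>R x"
      have z: "z \<in> N" "norm z = 1" using N x \<open>norm x \<noteq> 0\<close> by (auto simp: z_def subspace_scale)
      have "norm (f z) < d"
      proof -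
        have "norm (f z) = norm (f x) / norm x" by (simp add: z_def f.scale)
        also have "\<dots> < d / 2" using less \<open>norm x \<noteq> 0\<close> by (simp add: divide_less_eq)
        finally show ?thesis using d by simp
      qed
      then show False using small[of "f z"] z gf by simp
    qed
  qed
qed

text \<open>The lower bound applied to differences gives injectivity and makes the inverse Lipschitz
  with constant \<open>1 / c\<close>.\<close>

lemma bounded_below_imp_homeomorphism:
  fixes f :: "'a::real_normed_vector \<Rightarrow> 'b::real_normed_vector"
  assumes f: "bounded_linear f" and N: "subspace N" and c: "0 < c"
    and below: "\<And>x. x \<in> N \<Longrightarrow> c * norm x \<le> norm (f x)"
  obtains g where "homeomorphism N (f ` N) f g"
proof -
  interpret f: bounded_linear f by fact
  have lower: "c * norm (x - y) \<le> norm (f x - f y)" if "x \<in> N" "y \<in> N" for x y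
    using below[of "x - y"] N that by (simp add: subspace_diff f.diff)
  have inj: "inj_on f N"
  proof (rule inj_onI)
    fix x y assume "x \<in> N" "y \<in> N" "f x = f y"
    then show "x = y" using lower[of x y] c by (simp add: mult_le_0_iff)
  qed
  define g where "g = inv_into N f"
  have "(1 / c)-lipschitz_on (f ` N) g"
    using c lower by (intro lipschitz_onI) (auto simp: g_def inj dist_norm field_simps)
  then have "continuous_on (f ` N) g" by (rule lipschitz_on_continuous_on)
  then have "homeomorphism N (f ` N) f g"
    using inj f.continuous_on[OF continuous_on_id] by (auto simp: homeomorphism_def g_def)
  then show thesis by (rule that)
qed

text \<open>Both sides of the estimate are continuous in \<open>x\<close>. This allows an arbitrary
  subspace from the definition of strict singularity to be replaced by a closed one.\<close>

lemma bounded_below_on_closure: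
  fixes f :: "'a::real_normed_vector \<Rightarrow> 'b::real_normed_vector"
  assumes f: "bounded_linear f"
    and below: "\<And>x. x \<in> N \<Longrightarrow> c * norm x \<le> norm (f x)" and x: "x \<in> closure N"
  shows "c * norm x \<le> norm (f x)"
proof -
  interpret f: bounded_linear f by fact
  have "closed {x. c * norm x \<le> norm (f x)}"
    by (intro closed_Collect_le continuous_intros f.continuous_on)
  then have "closure N \<subseteq> {x. c * norm x \<le> norm (f x)}"
    by (intro closure_minimal) (auto intro: below)
  then show ?thesis using x by blast
qed

section \<open>Subspaces over the scalar field\<close>

context banach_space_over
begin

text \<open>Links subspaces over \<open>'k\<close> to the preceding section, where subspaces are
  real: real scalars act through \<open>of_real\<close>.\<close>

lemma subspace_imp_real_subspace: "subspace S \<Longrightarrow> Real_Vector_Spaces.subspace S"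
  unfolding Real_Vector_Spaces.subspace_def subspace_def by (metis scale_of_real)

lemma subspace_closure: "subspace S \<Longrightarrow> subspace (closure S)"
proof -
  assume S: "subspace S"
  have "s c x \<in> closure S" if x: "x \<in> closure S" for c x
  proof -
    \<comment> \<open>Real homogeneity holds because \<open>s c\<close> commutes with the action of
      \<open>of_real r\<close>; the bound is \<open>norm_scale\<close>. Continuity then carries the
      invariance of \<open>S\<close> over to its closure.\<close>
    have "bounded_linear (s c)"
      by (rule bounded_linear_intro[of _ "norm c"])
        (simp_all add: scale_right_distrib norm_scale scale_of_real[symmetric] scale_left_commute)
    moreover have "s c ` S \<subseteq> closure S"
      using subspace_scale[OF S] closure_subset[of S] by blast
    ultimately have "s c ` closure S \<subseteq> closure S"
      by (intro image_closure_subset linear_continuous_on closed_closure)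
    then show ?thesis using x by blast
  qed
  moreover have "x + y \<in> closure S" if xy: "x \<in> closure S" "y \<in> closure S" for x y
  proof -
    obtain u v where "\<forall>n. u n \<in> S" "u \<longlonglongrightarrow> x" "\<forall>n. v n \<in> S" "v \<longlonglongrightarrow> y"
      using xy unfolding closure_sequential by blast
    then have "\<forall>n. u n + v n \<in> S" "(\<lambda>n. u n + v n) \<longlonglongrightarrow> x + y"
      using subspace_add[OF S] tendsto_add by blast+
    then show ?thesis unfolding closure_sequential
      by (intro exI[of _ "\<lambda>n. u n + v n"] conjI)
  qed
  moreover have "0 \<in> closure S"
    using subspace_0[OF S] closure_subset by blast
  ultimately show ?thesis by (simp add: subspace_def)
qed

text \<open>A finite set spanning \<open>T\<close> need not lie in \<open>S\<close>, as the
  definition demands. A maximal independent subset of \<open>S\<close> does, and it is finite since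
  an independent set in the span of a finite set is finite.\<close>

lemma infinite_dimensional_mono:
  assumes "infinite_dimensional s S" and "S \<subseteq> T"
  shows "infinite_dimensional s T"
  unfolding infinite_dimensional_def
proof clarify
  fix F assume F: "finite F" "T \<subseteq> span F"
  obtain C where C: "C \<subseteq> S" "independent C" "S \<subseteq> span C"
    using maximal_independent_subset by blast
  then have "finite C"
    using independent_span_bound[OF F(1)] F(2) assms(2) by blast
  then show False using C assms(1) by (auto simp: infinite_dimensional_def)
qed

end

text \<open>Finite spanning sets correspond in both directions: a finite subset of the image is the
  image of a finite subset of \<open>S\<close>, and injectivity reflects inclusions in
  spans.\<close>

lemma infinite_dimensional_linear_image_iff:
  assumes "Vector_Spaces.linear s1 s2 f" and inj: "inj f"
  shows "infinite_dimensional s2 (f ` S) \<longleftrightarrow> infinite_dimensional s1 S"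
proof -
  interpret Vector_Spaces.linear s1 s2 f by fact
  have *: "f ` S \<subseteq> vs2.span (f ` F) \<longleftrightarrow> S \<subseteq> vs1.span F" for F
    using inj by (simp add: span_image inj_image_subset_iff)
  show ?thesis
    unfolding infinite_dimensional_def
  proof (intro arg_cong[where f = Not] iffI; elim exE conjE)
    fix G assume "finite G" "G \<subseteq> f ` S" "f ` S \<subseteq> vs2.span G"
    then show "\<exists>F. finite F \<and> F \<subseteq> S \<and> S \<subseteq> vs1.span F"
      using * by (metis finite_subset_image)
  next
    fix F assume "finite F" "F \<subseteq> S" "S \<subseteq> vs1.span F"
    then show "\<exists>G. finite G \<and> G \<subseteq> f ` S \<and> f ` S \<subseteq> vs2.span G"
      using * by (intro exI[of _ "f ` F"]) auto
  qed
qed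

lemma bounded_operator_imp_bounded_linear:
  assumes "banach_space_over s1" "banach_space_over s2" and B: "bounded_operator s1 s2 B"
  shows "bounded_linear B"
proof -
  interpret b1: banach_space_over s1 by fact
  interpret b2: banach_space_over s2 by fact
  interpret Vector_Spaces.linear s1 s2 B using B by (simp add: bounded_operator_def)
  obtain K where "\<And>x. norm (B x) \<le> K * norm x" using B by (auto simp: bounded_operator_def)
  moreover have "B (r *\<^sub>R x) = r *\<^sub>R B x" for r x
    using scale[of "of_real r" x] by (simp add: b1.scale_of_real b2.scale_of_real)
  ultimately show ?thesis
    by (intro bounded_linear_intro[of _ K]) (simp_all add: add mult.commute)
qed

section \<open>Type II ill-posedness and strict singularity\<close>

theorem proposition4p4:
  fixes s1 :: "'k::real_normed_field \<Rightarrow> 'a::banach \<Rightarrow> 'a"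
    and s2 :: "'k \<Rightarrow> 'b::banach \<Rightarrow> 'b"
    and B :: "'a \<Rightarrow> 'b"
  assumes "banach_space_over s1" and "banach_space_over s2"
    and "infinite_dimensional s1 UNIV" and "infinite_dimensional s2 UNIV"
    and "bounded_operator s1 s2 B" and "inj B"
  shows "ill_posed_type_II s2 B \<longleftrightarrow> strictly_singular s1 s2 B"
proof -
  interpret b1: banach_space_over s1 by fact
  interpret b2: banach_space_over s2 by fact
  have lin: "Vector_Spaces.linear s1 s2 B" using assms(5) by (simp add: bounded_operator_def)
  interpret B: Vector_Spaces.linear s1 s2 B by (rule lin)
  have bl: "bounded_linear B" by (rule bounded_operator_imp_bounded_linear[OF assms(1,2,5)])
  have rl: "Real_Vector_Spaces.linear B" using bl by (rule bounded_linear.linear)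
  note dim_image = infinite_dimensional_linear_image_iff[OF lin \<open>inj B\<close>]
  let ?M = "\<lambda>M. M \<subseteq> range B \<and> b2.subspace M \<and> closed M \<and> infinite_dimensional s2 M"
  \<comment> \<open>A closed range would itself be a closed infinite dimensional subspace, as
    \<open>B\<close> is injective on an infinite dimensional space. Absence of such subspaces
    therefore already forces ill-posedness.\<close>
  have "?M (range B)" if "closed (range B)"
    using that B.subspace_image[OF b1.subspace_UNIV] dim_image[of UNIV] assms(3) by simp
  then have "ill_posed_type_II s2 B \<longleftrightarrow> (\<nexists>M. ?M M)"
    unfolding ill_posed_type_II_def ill_posed_type_I_def ill_posed_def well_posed_def by blast
  also have "\<dots> \<longleftrightarrow> strictly_singular s1 s2 B"
  proof
    assume noM: "\<nexists>M. ?M M"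
    show "strictly_singular s1 s2 B"
      unfolding strictly_singular_def
    proof (intro conjI allI impI notI assms(5); elim conjE exE)
      fix N g assume N: "b1.subspace N" "infinite_dimensional s1 N"
        and hom: "homeomorphism N (B ` N) B g"
      obtain c where c: "0 < c" and below: "\<And>x. x \<in> N \<Longrightarrow> c * norm x \<le> norm (B x)"
        using homeomorphism_imp_bounded_below[OF rl b1.subspace_imp_real_subspace[OF N(1)] hom]
        by blast
      \<comment> \<open>The image of \<open>N\<close> need not be closed, so the closure is used: it
        is complete and \<open>B\<close> is bounded below on it, hence its image is complete and
        therefore closed.\<close>
      have cl: "b1.subspace (closure N)" using N(1) by (rule b1.subspace_closure)
      have "complete (B ` closure N)"
        using bounded_below_on_closure[OF bl below]
        by (intro complete_isometric_image[OF c b1.subspace_imp_real_subspace[OF cl] bl])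
          (auto simp: complete_eq_closed)
      then have "?M (B ` closure N)"
        using B.subspace_image[OF cl] dim_image b1.infinite_dimensional_mono[OF N(2) closure_subset]
        by (auto simp: complete_eq_closed)
      with noM show False by blast
    qed
  next
    assume sing: "strictly_singular s1 s2 B"
    show "\<nexists>M. ?M M"
    proof clarify
      fix M assume M: "M \<subseteq> range B" "b2.subspace M" "closed M" "infinite_dimensional s2 M"
      \<comment> \<open>The full preimage is closed by continuity and, since \<open>M\<close> lies
        in the range, is mapped onto the closed set \<open>M\<close>; this is the setting of the
        open mapping bound.\<close>
      define N where "N = B -` M"
      have BN: "B ` N = M" using M(1) by (auto simp: N_def)
      have N: "b1.subspace N" unfolding N_def using M(2) by (rule B.subspace_vimage)
      have dimN: "infinite_dimensional s1 N" using M(4) dim_image[of N] BN by simp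
      have "closed N"
        unfolding N_def
        by (rule closed_vimage[OF M(3)]) (rule linear_continuous_on[OF bl])
      then obtain c where "0 < c" "\<And>x. x \<in> N \<Longrightarrow> c * norm x \<le> norm (B x)"
        using closed_image_bounded_below[OF bl b1.subspace_imp_real_subspace[OF N]] M(3) BN
          inj_on_subset[OF \<open>inj B\<close>] by (metis subset_UNIV)
      then obtain g where "homeomorphism N (B ` N) B g"
        using bounded_below_imp_homeomorphism[OF bl b1.subspace_imp_real_subspace[OF N]] by metis
      then show False using sing N dimN unfolding strictly_singular_def by blast
    qed
  qed
  finally show ?thesis .
qed

end
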